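(* Let $H$ be a non-empty subset of a generalized group $G$. The following are equivalent: (i) $H$ is a generalized subgroup of $G$; (ii) for all $a,b\in H$, $ab^{-1}\in H$; (iii) for all $a,b\in H$, $ab\in H$, and for every $a\in H$, $a^{-1}\in H$.
   Context: A generalized group is a non-empty set $G$ with a binary operation (written multiplicatively) such that: (i) $(xy)z=x(yz)$ for all $x,y,z\in G$; (ii) for each $x\in G$ there exists a unique element $e(x)\in G$ such that $xe(x)=e(x)x=x$; (iii) for each $x\in G$ there exists $x^{-1}\in G$ such that $xx^{-1}=x^{-1}x=e(x)$. In a generalized group, the element $x^{-1}$ in (iii) is unique for each $x$. A generalized subgroup of $G$ is a non-empty subset of $G$ that is closed under the operation of $G$ and is itself a generalized group under that operation. *)

theory Defs
  imports Main
begin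

text \<open>A binary operation on a set \<open>G\<close> is a total HOL function that maps \<open>G \<times> G\<close> into \<open>G\<close>; its values
  elsewhere are irrelevant.\<close>

definition gg_id :: "'a set \<Rightarrow> ('a \<Rightarrow> 'a \<Rightarrow> 'a) \<Rightarrow> 'a \<Rightarrow> 'a" where
  "gg_id G mult x = (THE e. e \<in> G \<and> mult x e = x \<and> mult e x = x)"

definition gg_inv :: "'a set \<Rightarrow> ('a \<Rightarrow> 'a \<Rightarrow> 'a) \<Rightarrow> 'a \<Rightarrow> 'a" where
  "gg_inv G mult x = (THE y. y \<in> G \<and> mult x y = gg_id G mult x \<and> mult y x = gg_id G mult x)"

locale generalized_group =
  fixes G :: "'a set" and mult :: "'a \<Rightarrow> 'a \<Rightarrow> 'a" (infixl "\<cdot>" 70)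
  assumes nonempty: "G \<noteq> {}"
    and closed: "\<lbrakk>x \<in> G; y \<in> G\<rbrakk> \<Longrightarrow> x \<cdot> y \<in> G"
    and assoc: "\<lbrakk>x \<in> G; y \<in> G; z \<in> G\<rbrakk> \<Longrightarrow> (x \<cdot> y) \<cdot> z = x \<cdot> (y \<cdot> z)"
    and ex1_id: "x \<in> G \<Longrightarrow> \<exists>!e. e \<in> G \<and> x \<cdot> e = x \<and> e \<cdot> x = x"
    and ex_inv: "x \<in> G \<Longrightarrow> \<exists>y\<in>G. x \<cdot> y = gg_id G (\<cdot>) x \<and> y \<cdot> x = gg_id G (\<cdot>) x"

text \<open>The identities and inverses required of \<open>H\<close> in its own right are \<open>gg_id H mult\<close> and
  \<open>gg_inv H mult\<close>; they are not assumed to agree with those of \<open>G\<close>.\<close>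

definition generalized_subgroup :: "'a set \<Rightarrow> 'a set \<Rightarrow> ('a \<Rightarrow> 'a \<Rightarrow> 'a) \<Rightarrow> bool" where
  "generalized_subgroup H G mult \<longleftrightarrow>
     H \<noteq> {} \<and> H \<subseteq> G \<and> (\<forall>x\<in>H. \<forall>y\<in>H. mult x y \<in> H) \<and> generalized_group H mult"

context generalized_group
begin

lemma gg_id_props:
  assumes "x \<in> G"
  shows "gg_id G (\<cdot>) x \<in> G" "x \<cdot> gg_id G (\<cdot>) x = x" "gg_id G (\<cdot>) x \<cdot> x = x"
  using theI'[OF ex1_id[OF assms]] unfolding gg_id_def by blast+

lemma gg_id_eqI:
  assumes "x \<in> G" "e \<in> G" "x \<cdot> e = x" "e \<cdot> x = x"
  shows "gg_id G (\<cdot>) x = e"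
  using ex1_id[OF assms(1)] gg_id_props[OF assms(1)] assms by blast

text \<open>Uniqueness of inverses, so that the description in \<open>gg_inv\<close> is proper.\<close>

lemma ex1_inv:
  assumes x: "x \<in> G"
  shows "\<exists>!y. y \<in> G \<and> x \<cdot> y = gg_id G (\<cdot>) x \<and> y \<cdot> x = gg_id G (\<cdot>) x"
proof -
  let ?e = "gg_id G (\<cdot>)"
  note ex = gg_id_props[OF x]
  have "?e x \<cdot> ?e x = ?e x"
    using gg_id_eqI[OF x closed[OF ex(1) ex(1)]] assoc x ex by metis
  then have idem: "?e (?e x) = ?e x"
    using gg_id_eqI ex(1) by blast
  have same_id: "?e y = ?e x" if y: "y \<in> G" "x \<cdot> y = ?e x" "y \<cdot> x = ?e x" for y
  proof -
    note ey = gg_id_props[OF y(1)]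
    have "?e x \<cdot> ?e y = ?e x" using assoc[OF x y(1) ey(1)] y ey by simp
    moreover have "?e y \<cdot> ?e x = ?e x" using assoc[OF ey(1) y(1) x] y ey by simp
    ultimately show ?thesis using gg_id_eqI[OF ex(1) ey(1)] idem by simp
  qed
  have "y = z" if y: "y \<in> G" "x \<cdot> y = ?e x" "y \<cdot> x = ?e x"
    and z: "z \<in> G" "x \<cdot> z = ?e x" "z \<cdot> x = ?e x" for y z
    using assoc[OF y(1) x z(1)] same_id[OF y] same_id[OF z]
      gg_id_props[OF y(1)] gg_id_props[OF z(1)] y z by simp
  then show ?thesis using ex_inv[OF x] by blast
qed

end

end

theory Submission
  imports Defs
begin

text \<open>Uniqueness of identities and of inverses in \<open>G\<close> forces the identity and the inverse of an element
  of a generalized subgroup to be those of \<open>G\<close>. Conversely, \<open>e(a) = a a\<inverse>\<close>, and then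
  \<open>a\<inverse> = e(a) a\<inverse>\<close> and \<open>a b = a (b\<inverse>)\<inverse>\<close>, so closure under \<open>a b\<inverse>\<close> gives all the rest.\<close>

context generalized_group
begin

lemma gg_inv_props:
  assumes "x \<in> G"
  shows "gg_inv G (\<cdot>) x \<in> G"
    "x \<cdot> gg_inv G (\<cdot>) x = gg_id G (\<cdot>) x" "gg_inv G (\<cdot>) x \<cdot> x = gg_id G (\<cdot>) x"
  using theI'[OF ex1_inv[OF assms]] unfolding gg_inv_def by blast+

lemma gg_inv_eqI:
  assumes "x \<in> G" "y \<in> G" "x \<cdot> y = gg_id G (\<cdot>) x" "y \<cdot> x = gg_id G (\<cdot>) x"
  shows "gg_inv G (\<cdot>) x = y"
  using ex1_inv[OF assms(1)] gg_inv_props[OF assms(1)] assms by blast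

text \<open>By associativity the square of \<open>gg_id G (\<cdot>) x\<close> also fixes
  \<open>x\<close> from both sides, so uniqueness makes this element idempotent. It is then an
  identity for itself.\<close>

lemma gg_id_idem:
  assumes x: "x \<in> G"
  shows "gg_id G (\<cdot>) (gg_id G (\<cdot>) x) = gg_id G (\<cdot>) x"
proof -
  let ?e = "gg_id G (\<cdot>) x"
  note e = gg_id_props[OF x]
  have "?e \<cdot> ?e = ?e"
    using gg_id_eqI[OF x closed[OF e(1) e(1)]] assoc[OF x e(1) e(1)] assoc[OF e(1) e(1) x] e by simp
  then show ?thesis using gg_id_eqI[OF e(1) e(1)] by simp
qed

text \<open>For \<open>y\<close> the inverse of \<open>x\<close>, e(x) e(y) = x (y e(y)) = x y =
  e(x), and symmetrically on the other side. Thus e(y) is an identity for e(x), and the only such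
  element is e(x) itself by \<open>gg_id_idem\<close>.\<close>

lemma gg_id_gg_inv:
  assumes x: "x \<in> G"
  shows "gg_id G (\<cdot>) (gg_inv G (\<cdot>) x) = gg_id G (\<cdot>) x"
proof -
  let ?y = "gg_inv G (\<cdot>) x"
  note y = gg_inv_props[OF x] and e = gg_id_props[OF x] and f = gg_id_props[OF gg_inv_props(1)[OF x]]
  have "gg_id G (\<cdot>) x \<cdot> gg_id G (\<cdot>) ?y = gg_id G (\<cdot>) x"
    using assoc[OF x y(1) f(1)] y f by simp
  moreover have "gg_id G (\<cdot>) ?y \<cdot> gg_id G (\<cdot>) x = gg_id G (\<cdot>) x"
    using assoc[OF f(1) y(1) x] y f by simp
  ultimately show ?thesis
    using gg_id_eqI[OF e(1) f(1)] gg_id_idem[OF x] by simp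
qed

text \<open>Since an element and its inverse share their identity, the equations characterising an
  inverse are symmetric in the two.\<close>

lemma gg_inv_gg_inv:
  assumes "x \<in> G"
  shows "gg_inv G (\<cdot>) (gg_inv G (\<cdot>) x) = x"
  using assms by (intro gg_inv_eqI) (simp_all add: gg_inv_props gg_id_gg_inv)

lemma gg_id_subgroup:
  assumes "generalized_subgroup H G (\<cdot>)" "x \<in> H"
  shows "gg_id H (\<cdot>) x = gg_id G (\<cdot>) x"
proof -
  interpret H: generalized_group H "(\<cdot>)"
    using assms(1) unfolding generalized_subgroup_def by blast
  have "H \<subseteq> G" using assms(1) unfolding generalized_subgroup_def by blast
  then show ?thesis
    using gg_id_eqI[of x "gg_id H (\<cdot>) x"] H.gg_id_props[OF assms(2)] assms(2) by (auto simp: subset_iff)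
qed

text \<open>An inverse in \<open>H\<close> is taken relative to \<open>gg_id H (\<cdot>)\<close>;
  only after \<open>gg_id_subgroup\<close> does uniqueness of inverses in \<open>G\<close> apply to
  it.\<close>

lemma gg_inv_subgroup:
  assumes "generalized_subgroup H G (\<cdot>)" "x \<in> H"
  shows "gg_inv H (\<cdot>) x = gg_inv G (\<cdot>) x"
proof -
  interpret H: generalized_group H "(\<cdot>)"
    using assms(1) unfolding generalized_subgroup_def by blast
  have "H \<subseteq> G" using assms(1) unfolding generalized_subgroup_def by blast
  then show ?thesis
    using gg_inv_eqI[of x "gg_inv H (\<cdot>) x"] H.gg_inv_props[OF assms(2)]
      gg_id_subgroup[OF assms] assms(2) by (auto simp: subset_iff)
qed

lemma generalized_subgroup_closed:
  assumes "generalized_subgroup H G (\<cdot>)"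
  shows "\<lbrakk>a \<in> H; b \<in> H\<rbrakk> \<Longrightarrow> a \<cdot> b \<in> H" "a \<in> H \<Longrightarrow> gg_inv G (\<cdot>) a \<in> H"
proof -
  interpret H: generalized_group H "(\<cdot>)"
    using assms unfolding generalized_subgroup_def by blast
  show "\<lbrakk>a \<in> H; b \<in> H\<rbrakk> \<Longrightarrow> a \<cdot> b \<in> H" by (rule H.closed)
  show "a \<in> H \<Longrightarrow> gg_inv G (\<cdot>) a \<in> H"
    using H.gg_inv_props(1) gg_inv_subgroup[OF assms] by metis
qed

lemma generalized_subgroupI:
  assumes HG: "H \<subseteq> G" and ne: "H \<noteq> {}"
    and mult: "\<And>a b. \<lbrakk>a \<in> H; b \<in> H\<rbrakk> \<Longrightarrow> a \<cdot> b \<in> H"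
    and inv: "\<And>a. a \<in> H \<Longrightarrow> gg_inv G (\<cdot>) a \<in> H"
  shows "generalized_subgroup H G (\<cdot>)"
proof -
  have id: "gg_id G (\<cdot>) a \<in> H" if "a \<in> H" for a
    using mult[OF that inv[OF that]] gg_inv_props(2) that HG by auto
  have id_unique: "e = gg_id G (\<cdot>) a" if "a \<in> H" "e \<in> H" "a \<cdot> e = a" "e \<cdot> a = a" for a e
    using gg_id_eqI[of a e] that HG by auto
  \<comment> \<open>The inverse axiom for \<open>H\<close> refers to
    \<open>gg_id H (\<cdot>)\<close>, so this must be computed before inverses from \<open>G\<close>
    can serve. \<open>gg_id_subgroup\<close> would be circular here, as it presupposes that
    \<open>H\<close> is a generalized subgroup.\<close>
  have id_H: "gg_id H (\<cdot>) a = gg_id G (\<cdot>) a" if a: "a \<in> H" for a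
    unfolding gg_id_def[of H]
    using id[OF a] id_unique[OF a] gg_id_props[of a] a HG by (intro the_equality) blast+
  have "generalized_group H (\<cdot>)"
  proof
    show "\<exists>!e. e \<in> H \<and> a \<cdot> e = a \<and> e \<cdot> a = a" if a: "a \<in> H" for a
      using id[OF a] id_unique[OF a] gg_id_props[of a] a HG
      by (intro ex1I[of _ "gg_id G (\<cdot>) a"]) blast+
    show "\<exists>y\<in>H. a \<cdot> y = gg_id H (\<cdot>) a \<and> y \<cdot> a = gg_id H (\<cdot>) a" if a: "a \<in> H" for a
      using inv[OF a] gg_inv_props[of a] id_H[OF a] a HG by auto
  qed (use ne mult assoc HG in \<open>auto simp: subset_iff\<close>)
  then show ?thesis
    unfolding generalized_subgroup_def using ne HG mult by blast
qed

lemma closed_mult_inv_iff: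
  assumes HG: "H \<subseteq> G"
  shows "(\<forall>a\<in>H. \<forall>b\<in>H. a \<cdot> gg_inv G (\<cdot>) b \<in> H) \<longleftrightarrow>
    (\<forall>a\<in>H. \<forall>b\<in>H. a \<cdot> b \<in> H) \<and> (\<forall>a\<in>H. gg_inv G (\<cdot>) a \<in> H)"
proof
  assume div: "\<forall>a\<in>H. \<forall>b\<in>H. a \<cdot> gg_inv G (\<cdot>) b \<in> H"
  have inv: "gg_inv G (\<cdot>) a \<in> H" if a: "a \<in> H" for a
  proof -
    have aG: "a \<in> G" using a HG by blast
    have "gg_id G (\<cdot>) a \<in> H" using div a gg_inv_props(2)[OF aG] by metis
    \<comment> \<open>The identity of the inverse is that of \<open>a\<close>, so multiplying by it
      changes nothing. Applying \<open>div\<close> to the pair \<open>gg_id G (\<cdot>) a\<close>,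
      \<open>a\<close> then yields the inverse alone.\<close>
    moreover have "gg_id G (\<cdot>) a \<cdot> gg_inv G (\<cdot>) a = gg_inv G (\<cdot>) a"
      using gg_id_props(3)[OF gg_inv_props(1)[OF aG]] gg_id_gg_inv[OF aG] by simp
    ultimately show ?thesis using div a by metis
  qed
  moreover have "a \<cdot> b \<in> H" if "a \<in> H" "b \<in> H" for a b
    using div that inv[OF that(2)] gg_inv_gg_inv[of b] HG by (metis subsetD)
  ultimately show "(\<forall>a\<in>H. \<forall>b\<in>H. a \<cdot> b \<in> H) \<and> (\<forall>a\<in>H. gg_inv G (\<cdot>) a \<in> H)" by blast
qed blast

end

theorem theorem3p4:
  fixes G H :: "'a set" and mult :: "'a \<Rightarrow> 'a \<Rightarrow> 'a" (infixl "\<cdot>" 70)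
  assumes "generalized_group G (\<cdot>)"
    and "H \<subseteq> G" and "H \<noteq> {}"
  shows "(generalized_subgroup H G (\<cdot>) \<longleftrightarrow> (\<forall>a\<in>H. \<forall>b\<in>H. a \<cdot> gg_inv G (\<cdot>) b \<in> H)) \<and>
         ((\<forall>a\<in>H. \<forall>b\<in>H. a \<cdot> gg_inv G (\<cdot>) b \<in> H) \<longleftrightarrow>
           (\<forall>a\<in>H. \<forall>b\<in>H. a \<cdot> b \<in> H) \<and> (\<forall>a\<in>H. gg_inv G (\<cdot>) a \<in> H))"
proof -
  interpret generalized_group G "(\<cdot>)" by fact
  \<comment> \<open>Closure under products and inverses is the middle term: both other conditions
    are compared with it, and the stated equivalences follow by chaining.\<close>
  have "generalized_subgroup H G (\<cdot>) \<longleftrightarrow>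
      (\<forall>a\<in>H. \<forall>b\<in>H. a \<cdot> b \<in> H) \<and> (\<forall>a\<in>H. gg_inv G (\<cdot>) a \<in> H)"
    using generalized_subgroup_closed[of H] generalized_subgroupI[OF assms(2,3)] by blast
  then show ?thesis using closed_mult_inv_iff[OF assms(2)] by simp
qed

end
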